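(* There exists a continuous semigroup $\{\Phi_t\}_{t\ge0}$ in the class $\mathcal{G}_\infty$ such that $\Phi_t\notin\mathcal{G}_{\mathcal{A}}$ for every $t>0$.
   Context: $\mathbb{N}=\{1,2,\dots\}$. For $\theta\in\mathbb{R}$, $\mathbb{C}_\theta=\{s\in\mathbb{C}:\mathrm{Re}(s)>\theta\}$ and $\mathbb{C}_+=\mathbb{C}_0$. $\mathcal{D}$ is the set of Dirichlet series $\sum_{n\ge1}a_nn^{-s}$ that converge in some half-plane $\mathbb{C}_\theta$; an analytic function on $\mathbb{C}_+$ is said to be in $\mathcal{D}$ if it coincides with such a series on some half-plane. An analytic $\Phi:\mathbb{C}_+\to\mathbb{C}_+$ is in $\mathcal{G}_\infty$ if there are $c_\Phi\in\mathbb{N}\cup\{0\}$ and $\varphi\in\mathcal{D}$ with $\Phi(s)=c_\Phi s+\varphi(s)$. It is in $\mathcal{G}_{\mathcal{A}}$ if $\Phi\in\mathcal{G}_\infty$ and, for every $M>0$, $\Phi$ is uniformly continuous on $A_M=\{s\in\mathbb{C}_+:0<\mathrm{Re}(\Phi(s))<M\}$. A continuous semigroup in $\mathcal{G}_\infty$ is a family $\{\Phi_t\}_{t\ge0}\subset\mathcal{G}_\infty$ with $\Phi_0(s)=s$, $\Phi_t\circ\Phi_u=\Phi_{t+u}$ for all $t,u\ge0$, and $\Phi_t\to\Phi_0$ uniformly on compact subsets of $\mathbb{C}_+$ as $t\to0^+$. *)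

theory Defs
  imports "HOL-Complex_Analysis.Complex_Analysis"
begin

definition half_plane :: "real \<Rightarrow> complex set" where
  "half_plane \<theta> = {s. Re s > \<theta>}"

text \<open>
  Functions on the right half-plane \<open>half_plane 0\<close> are modelled as total functions of type
  \<open>complex \<Rightarrow> complex\<close>; their values elsewhere are irrelevant to every notion below.
\<close>

(* The series is the sum of a_n n^(-s) over n >= 1, whence the shift of the index. *)
definition dirichlet_sums :: "(nat \<Rightarrow> complex) \<Rightarrow> complex \<Rightarrow> complex \<Rightarrow> bool" where
  "dirichlet_sums a s l \<longleftrightarrow> (\<lambda>n. a (Suc n) * of_nat (Suc n) powr (- s)) sums l"

(* Analytic functions on half_plane 0 that coincide with a convergent Dirichlet series on some
   half-plane. The constraint \<theta> \<ge> 0 is no restriction (the half-plane may be shrunk); it keeps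
   the half-plane inside the domain of f. *)
definition class_D :: "(complex \<Rightarrow> complex) set" where
  "class_D = {f. f analytic_on half_plane 0 \<and>
     (\<exists>a. \<exists>\<theta>\<ge>0. \<forall>s\<in>half_plane \<theta>. dirichlet_sums a s (f s))}"

definition G_inf :: "(complex \<Rightarrow> complex) set" where
  "G_inf = {\<Phi>. \<Phi> analytic_on half_plane 0 \<and> \<Phi> ` half_plane 0 \<subseteq> half_plane 0 \<and>
     (\<exists>c::nat. \<exists>\<phi>\<in>class_D. \<forall>s\<in>half_plane 0. \<Phi> s = of_nat c * s + \<phi> s)}"

definition G_A :: "(complex \<Rightarrow> complex) set" where
  "G_A = {\<Phi>\<in>G_inf. \<forall>M>0.
     uniformly_continuous_on {s \<in> half_plane 0. 0 < Re (\<Phi> s) \<and> Re (\<Phi> s) < M} \<Phi>}"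

(* Only the members \<Phi> t with t \<ge> 0 belong to the family. *)
definition continuous_semigroup_G_inf :: "(real \<Rightarrow> complex \<Rightarrow> complex) \<Rightarrow> bool" where
  "continuous_semigroup_G_inf \<Phi> \<longleftrightarrow>
     (\<forall>t\<ge>0. \<Phi> t \<in> G_inf) \<and>
     (\<forall>s\<in>half_plane 0. \<Phi> 0 s = s) \<and>
     (\<forall>t\<ge>0. \<forall>u\<ge>0. \<forall>s\<in>half_plane 0. \<Phi> t (\<Phi> u s) = \<Phi> (t + u) s) \<and>
     (\<forall>K. compact K \<and> K \<subseteq> half_plane 0 \<longrightarrow> uniform_limit K \<Phi> (\<Phi> 0) (at_right 0))"

end

theory Submission
  imports Defs "HOL-Real_Asymp.Real_Asymp"
begin

text \<open>
  In the coordinate \<open>z = 2 powr (-s)\<close> a semigroup of self-maps of the disc fixing \<open>0\<close> is linearised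
  by its Koenigs function, a conformal map onto a domain that is starlike about \<open>0\<close>; conversely every
  such domain yields a semigroup \<open>\<Phi> t = K \<circ> (\<lambda>w. w + t) \<circ> H\<close> of self-maps of the right half-plane,
  where \<open>H\<close> is conformal onto a domain \<open>W\<close> closed under translation to the right and \<open>K\<close> is
  its inverse.

  Let the starlike domain be the plane minus radial slits outside the unit disc whose directions
  accumulate. Then \<open>W\<close> contains ever narrower horizontal channels \<open>a n < Im w < b n\<close> bounded by the
  half-lines \<open>Re w \<le> 0\<close>. A point at depth \<open>\<eta>\<close> in a channel of width \<open>\<epsilon>\<close> is mapped by \<open>K\<close> to
  within \<open>O(exp (- \<eta> / (4 * \<epsilon>)))\<close> of the imaginary axis, so by Schwarz-Pick the derivative of \<open>K\<close>
  tends to \<open>0\<close> along the middle of the channels. Hence two points at depths \<open>t / 4\<close> and \<open>t / 2\<close> in the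
  same channel have asymptotically equal images under \<open>K\<close>, although translation by \<open>t\<close> moves both out
  of the channel, where they stay apart: \<open>\<Phi> t\<close> is not uniformly continuous.
\<close>

section \<open>Schwarz-Pick bounds on the right half-plane\<close>

lemma Schwarz_Pick_right_half_plane:
  assumes holf: "f holomorphic_on ball c r" and r: "r > 0"
    and pos: "\<And>z. z \<in> ball c r \<Longrightarrow> Re (f z) > 0"
  shows "norm (deriv f c) \<le> 2 * Re (f c) / r"
proof -
  define h where "h = (\<lambda>z. f (c + of_real r * z))"
  \<comment> \<open>the Cayley transform turns \<open>h\<close> into a self-map of the disc fixing \<open>0\<close>\<close>
  define m where "m = (\<lambda>z. (h z - f c) / (h z + cnj (f c)))"
  have in_ball: "c + of_real r * z \<in> ball c r" if "norm z < 1" for z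
    using that r by (simp add: dist_norm norm_mult)
  have posh: "Re (h z) > 0" if "norm z < 1" for z
    using pos in_ball[OF that] by (simp add: h_def)
  have posc: "Re (f c) > 0"
    using pos r by simp
  have den: "h z + cnj (f c) \<noteq> 0" if "norm z < 1" for z
  proof
    assume "h z + cnj (f c) = 0"
    then have "Re (h z) + Re (f c) = 0"
      by (metis complex_cnj(1) complex.sel(1) plus_complex.sel(1) zero_complex.sel(1) complex_surj)
    with posh[OF that] posc show False by simp
  qed
  have derf: "(f has_field_derivative deriv f c) (at c)"
    using holf r by (simp add: holomorphic_derivI)
  have derh: "(h has_field_derivative of_real r * deriv f c) (at 0)"
  proof -
    have "((\<lambda>z. c + of_real r * z) has_field_derivative of_real r) (at 0)"
      by (auto intro!: derivative_eq_intros)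
    from DERIV_chain2[OF _ this, of f "deriv f c"] derf show ?thesis
      by (simp add: h_def mult.commute)
  qed
  have holh: "h holomorphic_on ball 0 1"
  proof -
    have "f \<circ> (\<lambda>z. c + of_real r * z) holomorphic_on ball 0 1"
      using in_ball
      by (intro holomorphic_on_compose_gen[OF _ holf]) (auto intro!: holomorphic_intros)
    then show ?thesis by (simp add: h_def o_def)
  qed
  have m: "m holomorphic_on ball 0 1"
    unfolding m_def using den by (auto intro!: holomorphic_intros holh)
  have "norm (m z) < 1" if "norm z < 1" for z
  proof -
    \<comment> \<open>The squared norms differ by \<open>4 * Re (h z) * Re (f c)\<close>.\<close>
    have "(norm (h z - f c))\<^sup>2 < (norm (h z + cnj (f c)))\<^sup>2"
      using posh[OF that] posc unfolding cmod_power2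
      by (simp add: power2_eq_square algebra_simps)
    then have "norm (h z - f c) < norm (h z + cnj (f c))"
      using power2_less_imp_less by fastforce
    then show ?thesis
      by (simp add: m_def norm_divide divide_less_eq)
  qed
  moreover have "m 0 = 0"
    by (simp add: m_def h_def)
  ultimately have "norm (deriv m 0) \<le> 1"
    using Schwarz_Lemma(2)[OF m, of 0] by simp
  moreover have "(m has_field_derivative of_real r * deriv f c / (2 * of_real (Re (f c)))) (at 0)"
  proof -
    have "h 0 = f c" by (simp add: h_def)
    moreover have "f c + cnj (f c) = 2 * of_real (Re (f c))"
      by (simp add: complex_add_cnj)
    ultimately show ?thesis
      unfolding m_def using derh den[of 0] posc
      by (auto intro!: derivative_eq_intros simp: field_simps power2_eq_square)
  qed
  ultimately have "norm (of_real r * deriv f c / (2 * of_real (Re (f c)))) \<le> 1"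
    by (simp add: DERIV_imp_deriv)
  then show ?thesis
    using r posc by (simp add: norm_mult norm_divide field_simps)
qed

text \<open>
  The square root opens the slit plane onto the right half-plane, where Schwarz-Pick applies on the
  largest disc about \<open>s\<close>.
\<close>
lemma conformal_slit_deriv_bound:
  assumes holH: "H holomorphic_on half_plane 0" and s: "Re s > 0"
    and slit: "\<And>z x. Re z > 0 \<Longrightarrow> x \<le> Re p \<Longrightarrow> H z \<noteq> Complex x (Im p)"
  shows "norm (deriv H s) \<le> 4 * norm (H s - p) / Re s"
proof -
  define F where "F = (\<lambda>z. csqrt (H z - p))"
  have nonneg: "H z - p \<notin> \<real>\<^sub>\<le>\<^sub>0" if "Re z > 0" for z
  proof
    assume "H z - p \<in> \<real>\<^sub>\<le>\<^sub>0"
    then have "Re (H z) \<le> Re p" "Im (H z) = Im p"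
      by (auto simp: complex_nonpos_Reals_iff)
    with slit[OF that, of "Re (H z)"] show False by (simp add: complex_eq_iff)
  qed
  have ball: "ball s (Re s) \<subseteq> {z. Re z > 0}"
  proof
    fix z assume "z \<in> ball s (Re s)"
    then have "\<bar>Re (s - z)\<bar> < Re s"
      using abs_Re_le_cmod[of "s - z"] by (simp add: dist_norm)
    then show "z \<in> {z. Re z > 0}" by simp
  qed
  have holF: "F holomorphic_on half_plane 0"
    unfolding F_def by (intro holomorphic_intros holH) (auto simp: half_plane_def nonneg)
  have "Re (F z) > 0" if "Re z > 0" for z
  proof -
    \<comment> \<open>The principal root has nonnegative real part; a purely imaginary root would
      put \<open>H z - p\<close> on the excluded half-line.\<close>
    have "Re (F z) \<noteq> 0"
    proof
      assume "Re (F z) = 0"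
      then have "(F z)\<^sup>2 = of_real (- (Im (F z))\<^sup>2)"
        by (simp add: complex_eq_iff Re_power2 Im_power2)
      moreover have "(F z)\<^sup>2 = H z - p" by (simp add: F_def)
      ultimately show False
        using nonneg[OF that] by (metis neg_le_0_iff_le nonpos_Reals_of_real_iff zero_le_power2)
    qed
    then show ?thesis using csqrt_principal[of "H z - p"] by (auto simp: F_def)
  qed
  then have "norm (deriv F s) \<le> 2 * Re (F s) / Re s"
    using ball s
    by (intro Schwarz_Pick_right_half_plane holomorphic_on_subset[OF holF])
       (auto simp: half_plane_def)
  also have "\<dots> \<le> 2 * norm (F s) / Re s"
    using s complex_Re_le_cmod[of "F s"] by (simp add: divide_right_mono)
  finally have le: "norm (deriv F s) \<le> 2 * norm (F s) / Re s" .
  have op: "open (half_plane 0)"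
    by (simp add: half_plane_def open_halfspace_Re_gt)
  have "(F has_field_derivative deriv F s) (at s)"
    using holomorphic_derivI[OF holF op] s by (simp add: half_plane_def)
  \<comment> \<open>The derivative of \<open>H\<close> is \<open>2 * F * F'\<close>, and the bound
    on \<open>F'\<close> is proportional to \<open>norm F\<close>; the product contains
    \<open>norm (F s ^ 2) = norm (H s - p)\<close>.\<close>
  then have "((\<lambda>z. F z ^ 2 + p) has_field_derivative 2 * F s * deriv F s) (at s)"
    by (auto intro!: derivative_eq_intros)
  moreover have "(\<lambda>z. F z ^ 2 + p) = H"
    by (simp add: F_def)
  ultimately have "deriv H s = 2 * F s * deriv F s"
    using DERIV_imp_deriv by metis
  then have "norm (deriv H s) = 2 * norm (F s) * norm (deriv F s)"
    by (simp add: norm_mult)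
  also have "\<dots> \<le> 2 * norm (F s) * (2 * norm (F s) / Re s)"
    using le by (intro mult_left_mono) auto
  also have "\<dots> = 4 * norm (F s ^ 2) / Re s"
    by (simp add: norm_power norm_mult power2_eq_square)
  finally show ?thesis by (simp add: F_def)
qed

section \<open>Dirichlet series from power series; continuity at time zero\<close>

text \<open>With \<open>z = 2 powr (-s)\<close> one has \<open>z ^ k = (2 ^ k) powr (-s)\<close>, so
  the Taylor series of \<open>q\<close> is a Dirichlet series supported on the powers of
  two.\<close>

lemma class_D_power_series:
  assumes q: "q holomorphic_on ball 0 1"
  shows "(\<lambda>s. q (exp (- (of_real (ln 2) * s)))) \<in> class_D"
proof -
  define f where "f = (\<lambda>s. q (exp (- (of_real (ln 2) * s))))"
  have in_ball: "exp (- (of_real (ln 2) * s)) \<in> ball 0 1" if "s \<in> half_plane 0" for s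
    using that by (simp add: half_plane_def)
  have "q \<circ> (\<lambda>s. exp (- (of_real (ln 2) * s))) holomorphic_on half_plane 0"
    using in_ball by (intro holomorphic_on_compose_gen[OF _ q]) (auto intro!: holomorphic_intros)
  then have "f analytic_on half_plane 0"
    by (simp add: f_def o_def analytic_on_open half_plane_def open_halfspace_Re_gt)
  define c where "c = (\<lambda>k. (deriv ^^ k) q 0 / fact k)"
  define a where "a = (\<lambda>n. if \<exists>k. n = (2::nat) ^ k then c (THE k. n = 2 ^ k) else (0::complex))"
  have a_pow: "a (2 ^ k) = c k" for k
  proof -
    have "(THE j. (2::nat) ^ k = 2 ^ j) = k" by (rule the_equality) auto
    then show ?thesis by (auto simp: a_def)
  qed
  have "dirichlet_sums a s (f s)" if s: "s \<in> half_plane 0" for s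
  proof -
    \<comment> \<open>Subtracting one matches the shifted index in \<open>dirichlet_sums\<close>:
      position \<open>2 ^ k - 1\<close> carries \<open>a (2 ^ k)\<close>.\<close>
    define g where "g = (\<lambda>k::nat. (2::nat) ^ k - 1)"
    have Suc_g: "Suc (g k) = 2 ^ k" for k by (simp add: g_def)
    have "strict_mono g"
      by (rule strict_monoI) (simp add: g_def diff_less_mono)
    moreover have "a (Suc n) * of_nat (Suc n) powr (- s) = 0" if "n \<notin> range g" for n
    proof -
      have "Suc n \<noteq> 2 ^ k" for k
        using that Suc_g by (metis nat.inject rangeI)
      then show ?thesis by (simp add: a_def)
    qed
    moreover have "(\<lambda>k. a (Suc (g k)) * of_nat (Suc (g k)) powr (- s)) sums f s"
    proof -
      have "complex_of_nat (2 ^ k) powr (- s) = exp (- (of_real (ln 2) * s)) ^ k" for k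
      proof -
        have "Ln (complex_of_nat (2 ^ k)) = of_real (ln (2 ^ k))"
          using Ln_of_real[of "2 ^ k"] by simp
        also have "ln ((2::real) ^ k) = k * ln 2" by (simp add: ln_realpow)
        finally show ?thesis
          by (simp add: powr_def exp_of_nat_mult [symmetric] algebra_simps)
      qed
      moreover have "(\<lambda>k. c k * exp (- (of_real (ln 2) * s)) ^ k) sums f s"
        using holomorphic_power_series[OF q in_ball[OF s]] by (simp add: c_def f_def)
      ultimately show ?thesis by (simp only: Suc_g a_pow)
    qed
    ultimately show ?thesis
      unfolding dirichlet_sums_def by (subst (asm) sums_mono_reindex) auto
  qed
  then show ?thesis
    using \<open>f analytic_on half_plane 0\<close> unfolding class_D_def f_def[symmetric] by blast
qed

text \<open>Heine-Cantor on the compact product: \<open>(t, s)\<close> and \<open>(0, s)\<close> lie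
  at distance \<open>t\<close>, whatever \<open>s\<close> is.\<close>

lemma uniform_limit_at_right_0:
  fixes \<Phi> :: "real \<Rightarrow> complex \<Rightarrow> complex"
  assumes "compact K" and cont: "continuous_on ({0..1} \<times> K) (\<lambda>(t, s). \<Phi> t s)"
  shows "uniform_limit K \<Phi> (\<Phi> 0) (at_right 0)"
proof (rule uniform_limitI)
  fix e :: real assume "e > 0"
  have "uniformly_continuous_on ({0..1} \<times> K) (\<lambda>(t, s). \<Phi> t s)"
    using assms by (intro compact_uniformly_continuous compact_Times) auto
  then obtain d where "d > 0"
    and d: "\<And>x y. x \<in> {0..1} \<times> K \<Longrightarrow> y \<in> {0..1} \<times> K \<Longrightarrow> dist y x < d
              \<Longrightarrow> dist (case y of (t, s) \<Rightarrow> \<Phi> t s) (case x of (t, s) \<Rightarrow> \<Phi> t s) < e"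
    using \<open>e > 0\<close> unfolding uniformly_continuous_on_def by metis
  have "\<forall>\<^sub>F t in at_right 0. t \<in> {0<..<min 1 d}"
    using \<open>d > 0\<close> by (intro eventually_at_right_real) auto
  then show "\<forall>\<^sub>F t in at_right 0. \<forall>s\<in>K. dist (\<Phi> t s) (\<Phi> 0 s) < e"
  proof eventually_elim
    case (elim t)
    then show ?case
      using d[of "(0, s)" "(t, s)" for s] by (auto simp: dist_Pair_Pair)
  qed
qed

section \<open>Narrow channels and the failure of uniform continuity\<close>

text \<open>
  Walking to the right from \<open>s0\<close>, the image under \<open>H\<close> has to leave the strip between the
  slits through its open end. Up to then \<open>|H'(s)| \<le> 4 (b - a) / Re s\<close>, so covering the distance
  \<open>\<eta>\<close> takes a logarithmically long walk, while \<open>Re H > 0\<close> as soon as \<open>Re s \<ge> B + 1\<close>.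
\<close>
lemma channel_depth_bound:
  assumes holH: "H holomorphic_on half_plane 0"
    and near: "\<And>s. Re s \<ge> 1 \<Longrightarrow> norm (H s - s) \<le> B"
    and slits: "\<And>s x. Re s > 0 \<Longrightarrow> x \<le> 0 \<Longrightarrow> H s \<noteq> Complex x a \<and> H s \<noteq> Complex x b"
    and s0: "Re s0 > 0" "a < Im (H s0)" "Im (H s0) < b" and \<eta>: "\<eta> > 0" "Re (H s0) \<le> - \<eta>"
  shows "Re s0 \<le> (B + 1) * exp (- \<eta> / (4 * (b - a)))"
proof -
  define \<epsilon> where "\<epsilon> = b - a"
  have "\<epsilon> > 0" using s0 by (simp add: \<epsilon>_def)
  \<comment> \<open>Once \<open>Re s \<ge> B + 1\<close>, \<open>near\<close> gives
    \<open>Re (H s) \<ge> 1\<close>, so the walk may stop at \<open>C\<close>.\<close>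
  define C where "C = B + 1"
  define v where "v = (\<lambda>x. H (Complex x (Im s0)))"
  have "B \<ge> 0" using order_trans[OF norm_ge_zero near[of 1]] by simp
  have large: "Re (H s) > 0" if "Re s \<ge> C" for s
  proof -
    have "\<bar>Re (H s) - Re s\<bar> \<le> B"
      using abs_Re_le_cmod[of "H s - s"] near[of s] that \<open>B \<ge> 0\<close> by (simp add: C_def)
    then show ?thesis using that by (simp add: C_def)
  qed
  have "Re s0 < C"
    using large[of s0] \<eta> by linarith
  have op: "open (half_plane 0)"
    by (simp add: half_plane_def open_halfspace_Re_gt)
  have der_v: "(v has_vector_derivative deriv H (Complex x (Im s0))) (at x)" if "x > 0" for x
  proof -
    have "(H has_field_derivative deriv H (Complex x (Im s0))) (at (Complex x (Im s0)))"
      using holomorphic_derivI[OF holH op] that by (simp add: half_plane_def)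
    moreover have "((\<lambda>x. Complex x (Im s0)) has_vector_derivative 1) (at x)"
    proof -
      have "(\<lambda>x. Complex x (Im s0)) = (\<lambda>x. of_real x + Complex 0 (Im s0))"
        by (auto simp: complex_eq_iff)
      then show ?thesis by (auto intro!: derivative_eq_intros)
    qed
    ultimately show ?thesis
      using field_vector_diff_chain_at[of "\<lambda>x. Complex x (Im s0)" 1 x H] by (simp add: v_def o_def)
  qed
  have cont_v: "continuous_on {Re s0..C} v"
    using s0 by (intro continuous_at_imp_continuous_on ballI has_vector_derivative_continuous[OF der_v])
      auto
  have vs0: "v (Re s0) = H s0" by (simp add: v_def)
  \<comment> \<open>The least element of \<open>T\<close> is the moment when the image of the walk
    first reaches the open end of the channel.\<close>
  define T where "T = {x \<in> {Re s0..C}. Re (v x) \<ge> 0}"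
  have "compact T"
  proof -
    have "closed T"
      unfolding T_def using cont_v
      by (intro continuous_on_closed_Collect_le continuous_intros) auto
    moreover have "T \<subseteq> {Re s0..C}" by (auto simp: T_def)
    ultimately show ?thesis
      by (metis compact_Icc compact_Int_closed inf.absorb2)
  qed
  moreover have "C \<in> T"
    using large[of "Complex C (Im s0)"] \<open>Re s0 < C\<close> by (simp add: T_def v_def)
  ultimately obtain x1 where x1: "x1 \<in> T" and x1_min: "\<And>x. x \<in> T \<Longrightarrow> x1 \<le> x"
    using compact_attains_inf[of T] by auto
  have neg: "Re (v x) < 0" if "Re s0 \<le> x" "x < x1" for x
    using x1_min[of x] that x1 by (force simp: T_def)
  have "Re s0 < x1"
    using x1 vs0 \<eta> by (cases "x1 = Re s0") (auto simp: T_def)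
  have "x1 \<le> C" "Re (v x1) \<ge> 0" using x1 by (auto simp: T_def)
  \<comment> \<open>Before \<open>x1\<close> the real part is negative, so leaving the strip would
    mean crossing a slit, by the intermediate value theorem.\<close>
  have strip: "a < Im (v x) \<and> Im (v x) < b" if "Re s0 \<le> x" "x < x1" for x
  proof (rule ccontr)
    assume notin: "\<not> ?thesis"
    have cont: "continuous_on {Re s0..x} (\<lambda>x. Im (v x))"
      using that \<open>x1 \<le> C\<close> by (intro continuous_intros continuous_on_subset[OF cont_v]) auto
    have "\<exists>y\<in>{Re s0..x}. Im (v y) = a \<or> Im (v y) = b"
      using notin IVT'[of "\<lambda>x. Im (v x)" "Re s0" b x] IVT2'[of "\<lambda>x. Im (v x)" x a "Re s0"]
        cont that s0 vs0 by force
    then obtain y where y: "Re s0 \<le> y" "y \<le> x" "Im (v y) = a \<or> Im (v y) = b" by auto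
    then have "Re (v y) < 0" using neg that by auto
    then show False
      using slits[of "Complex y (Im s0)" "Re (v y)"] y s0
      by (auto simp: v_def complex_eq_iff)
  qed
  have der_bound: "norm (deriv H (Complex x (Im s0))) \<le> 4 * \<epsilon> / x" if "Re s0 \<le> x" "x < x1" for x
  proof -
    let ?s = "Complex x (Im s0)"
    \<comment> \<open>The lower slit is cut back to end directly below \<open>H ?s\<close>, so that
      the distance to its tip is at most the channel width.\<close>
    let ?p = "Complex (Re (v x)) a"
    have "norm (deriv H ?s) \<le> 4 * norm (H ?s - ?p) / Re ?s"
      using that s0 neg[OF that] slits by (intro conformal_slit_deriv_bound[OF holH]) auto
    also have "norm (H ?s - ?p) = \<bar>Im (v x) - a\<bar>"
      by (simp add: v_def cmod_def)
    also have "4 * \<bar>Im (v x) - a\<bar> / Re ?s \<le> 4 * \<epsilon> / x"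
      using strip[OF that] that s0 by (auto simp: \<epsilon>_def intro!: divide_right_mono)
    finally show ?thesis .
  qed
  \<comment> \<open>Monotonicity of this difference stands in for integrating the derivative bound
    \<open>4 * \<epsilon> / x\<close>.\<close>
  have "Re (v x1) - 4 * \<epsilon> * ln x1 \<le> Re (v (Re s0)) - 4 * \<epsilon> * ln (Re s0)"
  proof (rule DERIV_nonpos_imp_decreasing_open[of "Re s0" x1])
    show "Re s0 \<le> x1" using \<open>Re s0 < x1\<close> by simp
    show "continuous_on {Re s0..x1} (\<lambda>x. Re (v x) - 4 * \<epsilon> * ln x)"
      using s0 \<open>x1 \<le> C\<close> by (intro continuous_intros continuous_on_subset[OF cont_v]) auto
    fix x assume x: "Re s0 < x" "x < x1"
    have "((\<lambda>x. Re (v x)) has_real_derivative Re (deriv H (Complex x (Im s0)))) (at x)"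
      using bounded_linear.has_vector_derivative[OF bounded_linear_Re der_v[of x]] x s0
      by (simp add: has_real_derivative_iff_has_vector_derivative)
    moreover have "((\<lambda>x. 4 * \<epsilon> * ln x) has_real_derivative 4 * \<epsilon> / x) (at x)"
      using x s0 by (auto intro!: derivative_eq_intros)
    ultimately have "((\<lambda>x. Re (v x) - 4 * \<epsilon> * ln x) has_real_derivative
        Re (deriv H (Complex x (Im s0))) - 4 * \<epsilon> / x) (at x)"
      by (rule DERIV_diff)
    moreover have "Re (deriv H (Complex x (Im s0))) - 4 * \<epsilon> / x \<le> 0"
      using der_bound[of x] x complex_Re_le_cmod[of "deriv H (Complex x (Im s0))"] by simp
    ultimately show "\<exists>y. ((\<lambda>x. Re (v x) - 4 * \<epsilon> * ln x) has_real_derivative y) (at x) \<and> y \<le> 0"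
      by blast
  qed
  then have "\<eta> \<le> 4 * \<epsilon> * (ln x1 - ln (Re s0))"
    using \<open>Re (v x1) \<ge> 0\<close> vs0 \<eta> by (simp add: algebra_simps)
  also have "\<dots> \<le> 4 * \<epsilon> * (ln C - ln (Re s0))"
    using \<open>\<epsilon> > 0\<close> \<open>x1 \<le> C\<close> \<open>Re s0 < x1\<close> s0 by (intro mult_left_mono) auto
  finally have "ln (Re s0) \<le> ln C + (- \<eta> / (4 * \<epsilon>))"
    using \<open>\<epsilon> > 0\<close> by (simp add: field_simps)
  then have "exp (ln (Re s0)) \<le> exp (ln C + (- \<eta> / (4 * \<epsilon>)))"
    by (simp only: exp_le_cancel_iff)
  then show ?thesis
    using s0 \<open>Re s0 < C\<close> unfolding exp_add by (simp add: \<epsilon>_def C_def)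
qed

lemma not_uniformly_continuous_translation:
  fixes t :: real
  assumes holH: "H holomorphic_on half_plane 0" and HW: "\<And>s. Re s > 0 \<Longrightarrow> H s \<in> W"
    and holK: "K holomorphic_on W" and "open W" and K_pos: "\<And>w. w \<in> W \<Longrightarrow> Re (K w) > 0"
    and HK: "\<And>w. w \<in> W \<Longrightarrow> H (K w) = w"
    and near: "\<And>s. Re s \<ge> 1 \<Longrightarrow> norm (H s - s) \<le> B"
    and slits: "\<And>n x. x \<le> 0 \<Longrightarrow> Complex x (a n) \<notin> W \<and> Complex x (b n) \<notin> W"
    and strips: "\<And>n w. a n < Im w \<Longrightarrow> Im w < b n \<Longrightarrow> w \<in> W"
    and right: "\<And>w. Re w > 0 \<Longrightarrow> w \<in> W"
    and ab: "\<And>n. a n < b n" and lim: "a \<longlonglongrightarrow> L" "b \<longlonglongrightarrow> L" and "t > 0"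
  shows "\<exists>M>0. \<not> uniformly_continuous_on
           {s \<in> half_plane 0. 0 < Re (K (H s + of_real t)) \<and> Re (K (H s + of_real t)) < M}
           (\<lambda>s. K (H s + of_real t))"
proof -
  define m where "m = (\<lambda>n. (a n + b n) / 2)"
  define \<epsilon> where "\<epsilon> = (\<lambda>n. b n - a n)"
  \<comment> \<open>Both depths lie strictly between \<open>0\<close> and \<open>t\<close>:
    translation by \<open>t\<close> carries the points into \<open>Re w > 0\<close>, where they tend
    to the distinct limits \<open>P\<close> and \<open>Q\<close>.\<close>
  define u1 where "u1 = (\<lambda>n. Complex (- t / 4) (m n))"
  define u2 where "u2 = (\<lambda>n. Complex (- t / 2) (m n))"
  define P where "P = Complex (3 * t / 4) L"
  define Q where "Q = Complex (t / 2) L"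
  \<comment> \<open>The margin above both limits keeps the translated images below \<open>M\<close>
    for large \<open>n\<close>.\<close>
  define M where "M = max (Re (K P)) (Re (K Q)) + 1"
  have \<epsilon>_pos: "\<epsilon> n > 0" for n using ab by (simp add: \<epsilon>_def)
  have PQ: "P \<in> W" "Q \<in> W" using right \<open>t > 0\<close> by (auto simp: P_def Q_def)
  have m: "m \<longlonglongrightarrow> L" unfolding m_def using tendsto_add[OF lim] by (auto intro!: tendsto_eq_intros lim)
  have \<epsilon>: "filterlim \<epsilon> (at_right 0) sequentially"
  proof (rule tendsto_imp_filterlim_at_right)
    show "\<epsilon> \<longlonglongrightarrow> 0" unfolding \<epsilon>_def using tendsto_diff[OF lim(2,1)] by simp
  qed (simp add: \<epsilon>_pos)
  \<comment> \<open>Points of the middle line are half a width away from the walls; this is the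
    radius for Schwarz-Pick.\<close>
  have ball_W: "ball w (\<epsilon> n / 2) \<subseteq> W" if "Im w = m n" for w n
  proof
    fix z assume "z \<in> ball w (\<epsilon> n / 2)"
    then have "\<bar>Im w - Im z\<bar> < \<epsilon> n / 2"
      using abs_Im_le_cmod[of "w - z"] by (simp add: dist_norm)
    then show "z \<in> W"
      using that by (intro strips[of n]) (auto simp: m_def \<epsilon>_def field_simps)
  qed
  have der_K: "norm (deriv K w) \<le> 4 * (B + 1) * exp (- (t / 4) / (4 * \<epsilon> n)) / \<epsilon> n"
    if w: "Im w = m n" "Re w \<le> - (t / 4)" for w n
  proof -
    have "w \<in> W" using ball_W[OF w(1)] \<epsilon>_pos by auto
    have depth: "Re (K w) \<le> (B + 1) * exp (- (t / 4) / (4 * \<epsilon> n))"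
      unfolding \<epsilon>_def
    proof (rule channel_depth_bound[OF holH near])
      show "H s \<noteq> Complex x (a n) \<and> H s \<noteq> Complex x (b n)" if "Re s > 0" "x \<le> 0" for s x
        using HW[OF that(1)] slits[OF that(2), of n] by auto
    qed (use w \<open>t > 0\<close> \<open>w \<in> W\<close> K_pos HK ab[of n] in \<open>auto simp: m_def\<close>)
    have "norm (deriv K w) \<le> 2 * Re (K w) / (\<epsilon> n / 2)"
      using ball_W[OF w(1)] \<epsilon>_pos[of n] K_pos
      by (intro Schwarz_Pick_right_half_plane holomorphic_on_subset[OF holK]) auto
    also have "\<dots> = 4 * Re (K w) / \<epsilon> n" by simp
    also have "\<dots> \<le> 4 * ((B + 1) * exp (- (t / 4) / (4 * \<epsilon> n))) / \<epsilon> n"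
      using depth \<epsilon>_pos[of n] by (intro divide_right_mono mult_left_mono) auto
    finally show ?thesis by (simp only: mult.assoc)
  qed
  have diff: "norm (K (u1 n) - K (u2 n))
      \<le> 4 * (B + 1) * exp (- (t / 4) / (4 * \<epsilon> n)) / \<epsilon> n * norm (u1 n - u2 n)" for n
  proof (rule field_differentiable_bound[of "closed_segment (u1 n) (u2 n)" K "deriv K"])
    fix z assume "z \<in> closed_segment (u1 n) (u2 n)"
    then obtain c where c: "0 \<le> c" "c \<le> 1" "z = (1 - c) *\<^sub>R u1 n + c *\<^sub>R u2 n"
      by (auto simp: in_segment)
    have "Im z = m n" "Re z = - (t / 4) - c * (t / 4)"
      unfolding c(3) by (simp_all add: u1_def u2_def algebra_simps)
    with c \<open>t > 0\<close> have z: "Im z = m n" "Re z \<le> - (t / 4)"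
      by auto
    then show "norm (deriv K z) \<le> 4 * (B + 1) * exp (- (t / 4) / (4 * \<epsilon> n)) / \<epsilon> n"
      by (rule der_K)
    have "z \<in> W" using ball_W[OF z(1)] \<epsilon>_pos by auto
    then show "(K has_field_derivative deriv K z) (at z within closed_segment (u1 n) (u2 n))"
      using holomorphic_derivI[OF holK \<open>open W\<close>] has_field_derivative_at_within by blast
  qed auto
  \<comment> \<open>The exponential decay outweighs the factor \<open>1 / e\<close> lost to
    Schwarz-Pick.\<close>
  have "((\<lambda>e. 4 * (B + 1) * exp (- (t / 4) / (4 * e)) / e) \<longlongrightarrow> 0) (at_right 0)"
    using \<open>t > 0\<close> by real_asymp
  from filterlim_compose[OF this \<epsilon>]
  have "(\<lambda>n. 4 * (B + 1) * exp (- (t / 4) / (4 * \<epsilon> n)) / \<epsilon> n) \<longlonglongrightarrow> 0" .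
  then have "(\<lambda>n. 4 * (B + 1) * exp (- (t / 4) / (4 * \<epsilon> n)) / \<epsilon> n * norm (u1 n - u2 n)) \<longlonglongrightarrow> 0 * (t / 4)"
  proof (rule tendsto_mult)
    have "u1 n - u2 n = of_real (t / 4)" for n
      by (auto simp: u1_def u2_def complex_eq_iff)
    then show "(\<lambda>n. norm (u1 n - u2 n)) \<longlonglongrightarrow> t / 4"
      using \<open>t > 0\<close> by (simp only: norm_of_real) simp
  qed
  then have "(\<lambda>n. 4 * (B + 1) * exp (- (t / 4) / (4 * \<epsilon> n)) / \<epsilon> n * norm (u1 n - u2 n)) \<longlonglongrightarrow> 0"
    by (simp only: mult_zero_left)
  then have close: "(\<lambda>n. dist (K (u1 n)) (K (u2 n))) \<longlonglongrightarrow> 0"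
    by (rule Lim_null_comparison[rotated]) (use diff in \<open>auto simp: dist_norm\<close>)
  have u_W: "u1 n \<in> W" "u2 n \<in> W" for n
    using ball_W[of "u1 n" n] ball_W[of "u2 n" n] \<epsilon>_pos[of n] by (auto simp: u1_def u2_def)
  have contK: "isCont K w" if "w \<in> W" for w
    using holK \<open>open W\<close> that by (meson continuous_on_eq_continuous_at holomorphic_on_imp_continuous_on)
  have "(\<lambda>n. u1 n + of_real t) \<longlonglongrightarrow> P" "(\<lambda>n. u2 n + of_real t) \<longlonglongrightarrow> Q"
    unfolding u1_def u2_def P_def Q_def using m
    by (auto simp: tendsto_complex_iff)
  then have lims: "(\<lambda>n. K (u1 n + of_real t)) \<longlonglongrightarrow> K P" "(\<lambda>n. K (u2 n + of_real t)) \<longlonglongrightarrow> K Q"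
    using contK PQ isCont_tendsto_compose by blast+
  have "\<forall>\<^sub>F n in sequentially. Re (K (u1 n + of_real t)) < M"
    by (rule order_tendstoD[OF tendsto_Re[OF lims(1)]]) (simp add: M_def)
  moreover have "\<forall>\<^sub>F n in sequentially. Re (K (u2 n + of_real t)) < M"
    by (rule order_tendstoD[OF tendsto_Re[OF lims(2)]]) (simp add: M_def)
  ultimately have below: "\<forall>\<^sub>F n in sequentially.
      Re (K (u1 n + of_real t)) < M \<and> Re (K (u2 n + of_real t)) < M"
    by eventually_elim simp
  have "P \<noteq> Q" using \<open>t > 0\<close> by (simp add: P_def Q_def)
  then have KPQ: "K P \<noteq> K Q" using HK PQ by metis
  have "M > 0" using K_pos[OF PQ(1)] by (simp add: M_def)
  moreover have False if uc: "uniformly_continuous_on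
           {s \<in> half_plane 0. 0 < Re (K (H s + of_real t)) \<and> Re (K (H s + of_real t)) < M}
           (\<lambda>s. K (H s + of_real t))" (is "uniformly_continuous_on ?S ?\<Phi>")
  proof -
    \<comment> \<open>Half the distance suffices: the bound by \<open>e\<close> survives the passage
      to the limits \<open>K P\<close> and \<open>K Q\<close>.\<close>
    define e where "e = dist (K P) (K Q) / 2"
    have "e > 0" using KPQ by (simp add: e_def)
    obtain d where "d > 0"
      and d: "\<And>x y. x \<in> ?S \<Longrightarrow> y \<in> ?S \<Longrightarrow> dist y x < d \<Longrightarrow> dist (?\<Phi> y) (?\<Phi> x) < e"
      by (rule uniformly_continuous_onE[OF uc \<open>e > 0\<close>]) (rule that)
    have "\<forall>\<^sub>F n in sequentially. dist (K (u1 n)) (K (u2 n)) < d"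
      using order_tendstoD(2)[OF close \<open>d > 0\<close>] .
    with below have "\<forall>\<^sub>F n in sequentially. dist (K (u1 n + of_real t)) (K (u2 n + of_real t)) \<le> e"
    proof eventually_elim
      case (elim n)
      have shift: "Re (K (u1 n + of_real t)) > 0" "Re (K (u2 n + of_real t)) > 0"
        using \<open>t > 0\<close> by (auto intro!: K_pos right simp: u1_def u2_def)
      have "K (u1 n) \<in> ?S" "K (u2 n) \<in> ?S"
        using elim shift K_pos u_W HK by (auto simp: half_plane_def)
      then have "dist (?\<Phi> (K (u1 n))) (?\<Phi> (K (u2 n))) < e"
        using d elim by auto
      then show ?case using HK u_W by simp
    qed
    then have "dist (K P) (K Q) \<le> e"
      by (intro tendsto_upperbound[OF tendsto_dist[OF lims]]) auto
    then show False using KPQ by (simp add: e_def)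
  qed
  ultimately show ?thesis by blast
qed

section \<open>Semigroups from starlike domains\<close>

text \<open>A Riemann map normalised by \<open>f 0 = 0\<close> has its only zero, a simple one, at
  \<open>0\<close>. Hence \<open>f u / u\<close> extends without zeros and has a holomorphic
  logarithm on the simply connected domain.\<close>

lemma Riemann_map_starlike:
  assumes "open \<Omega>" "0 \<in> \<Omega>" "\<Omega> \<noteq> UNIV"
    and star: "\<forall>u\<in>\<Omega>. \<forall>r\<in>{0..1}. of_real r * u \<in> \<Omega>"
  obtains f g l where "f holomorphic_on \<Omega>" "g holomorphic_on ball 0 1" "l holomorphic_on \<Omega>"
    "\<And>u. u \<in> \<Omega> \<Longrightarrow> norm (f u) < 1 \<and> g (f u) = u"
    "\<And>z. norm z < 1 \<Longrightarrow> g z \<in> \<Omega> \<and> f (g z) = z"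
    "\<And>u. u \<in> \<Omega> \<Longrightarrow> f u = u * exp (l u)"
proof -
  have "starlike \<Omega>"
    unfolding starlike_def
  proof (intro bexI ballI subsetI)
    fix u z assume "u \<in> \<Omega>" "z \<in> closed_segment 0 u"
    then show "z \<in> \<Omega>"
      using star by (auto simp: in_segment scaleR_conv_of_real)
  qed (use \<open>0 \<in> \<Omega>\<close> in auto)
  then have sc: "simply_connected \<Omega>"
    by (rule starlike_imp_simply_connected)
  obtain f0 g0 where holf0: "f0 holomorphic_on \<Omega>" and holg0: "g0 holomorphic_on ball 0 1"
    and f0: "\<And>u. u \<in> \<Omega> \<Longrightarrow> f0 u \<in> ball 0 1 \<and> g0 (f0 u) = u"
    and g0: "\<And>z. z \<in> ball 0 1 \<Longrightarrow> g0 z \<in> \<Omega> \<and> f0 (g0 z) = z"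
    using Riemann_mapping_theorem[of \<Omega>] sc assms by blast
  \<comment> \<open>A disc automorphism moves \<open>f0 0\<close> to \<open>0\<close>.\<close>
  obtain p q where p0: "p (f0 0) = 0"
    and holp: "p holomorphic_on ball 0 1" and p: "p ` ball 0 1 \<subseteq> ball 0 1"
    and holq: "q holomorphic_on ball 0 1" and q: "q ` ball 0 1 \<subseteq> ball 0 1"
    and pq: "\<And>z. z \<in> ball 0 1 \<Longrightarrow> p (q z) = z" and qp: "\<And>z. z \<in> ball 0 1 \<Longrightarrow> q (p z) = z"
    using ball_biholomorphism_exists[of "f0 0"] f0 \<open>0 \<in> \<Omega>\<close> by metis
  define f where "f = p \<circ> f0"
  define g where "g = g0 \<circ> q"
  have holf: "f holomorphic_on \<Omega>"
    unfolding f_def by (rule holomorphic_on_compose_gen[OF holf0 holp]) (use f0 in auto)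
  have holg: "g holomorphic_on ball 0 1"
    unfolding g_def by (rule holomorphic_on_compose_gen[OF holq holg0 q])
  have f: "norm (f u) < 1 \<and> g (f u) = u" if "u \<in> \<Omega>" for u
    using f0[OF that] p qp[of "f0 u"] by (auto simp: f_def g_def image_subset_iff)
  have g: "g z \<in> \<Omega> \<and> f (g z) = z" if "norm z < 1" for z
    using g0[of "q z"] q pq[of z] that by (auto simp: f_def g_def image_subset_iff)
  have "f 0 = 0" by (simp add: f_def p0)
  have "inj_on f \<Omega>" using f by (metis inj_onI)
  define k where "k = (\<lambda>z. if z = 0 then deriv f 0 else (f z - f 0) / (z - 0))"
  have "k holomorphic_on \<Omega>"
    unfolding k_def by (rule pole_lemma_open[OF holf \<open>open \<Omega>\<close>])
  moreover have "k u \<noteq> 0" if "u \<in> \<Omega>" for u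
  proof (cases "u = 0")
    case True
    then show ?thesis
      using holomorphic_injective_imp_regular[OF holf \<open>open \<Omega>\<close> \<open>inj_on f \<Omega>\<close>] that
      by (simp add: k_def)
  next
    case False
    then have "f u \<noteq> f 0"
      using \<open>inj_on f \<Omega>\<close> that \<open>0 \<in> \<Omega>\<close> by (auto dest: inj_onD)
    then show ?thesis using False by (simp add: k_def)
  qed
  ultimately obtain l where l: "l holomorphic_on \<Omega>" "\<And>u. u \<in> \<Omega> \<Longrightarrow> k u = exp (l u)"
    using simply_connected_eq_holomorphic_log[OF \<open>open \<Omega>\<close>] sc by metis
  have "f u = u * k u" for u
    using \<open>f 0 = 0\<close> by (simp add: k_def)
  then have fl: "f u = u * exp (l u)" if "u \<in> \<Omega>" for u
    using l(2)[OF that] by metis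
  show ?thesis
    by (rule that[OF holf holg l(1) f g fl])
qed

text \<open>
  With \<open>f u = u * exp (l u)\<close> the Riemann map and \<open>g\<close> its inverse, \<open>H\<close> is a logarithm of \<open>g\<close> in the
  coordinate \<open>z = 2 powr (-s)\<close>; factoring \<open>u\<close> out of \<open>f\<close> makes it single-valued. The semigroup
  is \<open>z \<mapsto> f (2 powr (-t) * g z)\<close> in this coordinate, whence the displacement \<open>\<Phi> t s - s\<close> is a power
  series in \<open>z\<close>.
\<close>
lemma starlike_domain_semigroup:
  assumes "open \<Omega>" "0 \<in> \<Omega>" "\<Omega> \<noteq> UNIV"
    and star: "\<forall>u\<in>\<Omega>. \<forall>r\<in>{0..1}. of_real r * u \<in> \<Omega>"
    and W_def: "W = {w. exp (- (of_real (ln 2) * w)) \<in> \<Omega>}"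
  obtains H K B where "H holomorphic_on half_plane 0" "K holomorphic_on W"
    "\<And>s. Re s > 0 \<Longrightarrow> H s \<in> W" "\<And>w. w \<in> W \<Longrightarrow> Re (K w) > 0"
    "\<And>w. w \<in> W \<Longrightarrow> H (K w) = w" "\<And>s. Re s \<ge> 1 \<Longrightarrow> norm (H s - s) \<le> B"
    "continuous_semigroup_G_inf (\<lambda>t s. K (H s + of_real t))"
proof -
  obtain f g l where holf: "f holomorphic_on \<Omega>" and holg: "g holomorphic_on ball 0 1"
    and holl: "l holomorphic_on \<Omega>"
    and f: "\<And>u. u \<in> \<Omega> \<Longrightarrow> norm (f u) < 1 \<and> g (f u) = u"
    and g: "\<And>z. norm z < 1 \<Longrightarrow> g z \<in> \<Omega> \<and> f (g z) = z"
    and l: "\<And>u. u \<in> \<Omega> \<Longrightarrow> f u = u * exp (l u)"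
    using Riemann_map_starlike[OF assms(1-4)] by metis
  define E where "E = (\<lambda>w::complex. exp (- (of_real (ln 2) * w)))"
  define c where "c = complex_of_real (ln 2)"
  have [simp]: "c \<noteq> 0" by (simp add: c_def)
  have normE: "norm (E w) < 1 \<longleftrightarrow> Re w > 0" for w
    by (simp add: E_def zero_less_mult_iff)
  have E_add: "E (w + z) = E w * E z" for w z
    by (simp add: E_def exp_add[symmetric] algebra_simps)
  have E_l: "E (l u / c) = exp (- l u)" for u
    by (simp add: E_def c_def)
  have holE: "E holomorphic_on S" for S
    unfolding E_def by (intro holomorphic_intros)
  have W_iff: "w \<in> W \<longleftrightarrow> E w \<in> \<Omega>" for w
    by (simp add: W_def E_def)
  \<comment> \<open>For \<open>u = g (E s)\<close> one has \<open>E s = u * exp (l u)\<close>;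
    adding \<open>l u / c\<close> to \<open>s\<close> divides \<open>E s\<close> by
    \<open>exp (l u)\<close>. \<open>K\<close> restores this factor.\<close>
  define H where "H = (\<lambda>s. s + l (g (E s)) / c)"
  define K where "K = (\<lambda>w. w - l (E w) / c)"
  have EH: "E (H s) = g (E s)" if "Re s > 0" for s
  proof -
    have gs: "g (E s) \<in> \<Omega>" "f (g (E s)) = E s" using g[of "E s"] that normE by auto
    have "E (H s) = f (g (E s)) * exp (- l (g (E s)))"
      by (simp add: H_def E_add E_l gs)
    also have "\<dots> = g (E s)"
      using l[OF gs(1)] by (simp add: exp_minus)
    finally show ?thesis .
  qed
  have HW: "H s \<in> W" if "Re s > 0" for s
    using g[of "E s"] that normE by (simp add: W_iff EH)
  have KH: "K (H s) = s" if "Re s > 0" for s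
    \<comment> \<open>\<open>K\<close> is unfolded first, while \<open>E (H s)\<close> is still in a
      form that \<open>EH\<close> rewrites; unfolding \<open>H\<close> then cancels the
      corrections.\<close>
    using EH[OF that] by (simp add: K_def) (simp add: H_def)
  have EK: "E (K w) = f (E w)" if "w \<in> W" for w
  proof -
    have "K w = w + - (l (E w) / c)" by (simp add: K_def)
    then have "E (K w) = E w * exp (l (E w))"
      by (simp only: E_add) (simp add: E_def c_def)
    then show ?thesis using l that by (simp add: W_iff)
  qed
  have K_pos: "Re (K w) > 0" if "w \<in> W" for w
    using f that normE[of "K w"] by (simp add: EK W_iff)
  have HK: "H (K w) = w" if "w \<in> W" for w
    using EK[OF that] f that by (simp add: H_def W_iff) (simp add: K_def)
  have op: "open (half_plane 0)"
    by (simp add: half_plane_def open_halfspace_Re_gt)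
  have holK: "K holomorphic_on W"
  proof -
    have "l \<circ> E holomorphic_on W"
      by (rule holomorphic_on_compose_gen[OF holE holl]) (auto simp: W_iff)
    then show ?thesis unfolding K_def o_def by (intro holomorphic_intros) auto
  qed
  have hollg: "(\<lambda>z. l (g z)) holomorphic_on ball 0 1"
    using holomorphic_on_compose_gen[OF holg holl] g by (simp add: o_def image_subset_iff)
  have holH: "H holomorphic_on half_plane 0"
  proof -
    have "(\<lambda>z. l (g z)) \<circ> E holomorphic_on half_plane 0"
      by (rule holomorphic_on_compose_gen[OF holE hollg]) (auto simp: half_plane_def normE)
    then show ?thesis unfolding H_def o_def by (intro holomorphic_intros) auto
  qed
  \<comment> \<open>Translation by \<open>t \<ge> 0\<close> multiplies \<open>E w\<close> by a real
    number in the unit interval, so starlikeness applies.\<close>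
  have shift: "w + of_real t \<in> W" if "w \<in> W" "t \<ge> 0" for w and t :: real
  proof -
    have "E (of_real t) = of_real (exp (- (ln 2 * t)))"
      by (simp add: E_def exp_of_real[symmetric])
    then show ?thesis
      using star[rule_format, of "E w" "exp (- (ln 2 * t))"] that by (simp add: W_iff E_add mult.commute)
  qed
  define \<Phi> where "\<Phi> = (\<lambda>t s. K (H s + of_real t))"
  \<comment> \<open>\<open>Re s \<ge> 1\<close> confines \<open>E s\<close> to the compact disc of
    radius \<open>1 / 2\<close>, where \<open>l (g z) / c\<close> is bounded.\<close>
  obtain B where B: "\<And>s. Re s \<ge> 1 \<Longrightarrow> norm (H s - s) \<le> B"
  proof -
    have "continuous_on (cball 0 (1 / 2)) (\<lambda>z. l (g z) / c)"
      by (intro continuous_intros holomorphic_on_imp_continuous_on holomorphic_on_subset[OF hollg])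
        auto
    then have "bounded ((\<lambda>z. l (g z) / c) ` cball 0 (1 / 2))"
      by (intro compact_imp_bounded compact_continuous_image) auto
    then obtain B where "\<forall>z\<in>cball 0 (1 / 2). norm (l (g z) / c) \<le> B"
      unfolding bounded_iff by blast
    then have B: "norm (l (g z) / c) \<le> B" if "norm z \<le> 1 / 2" for z
      using that by (simp only: mem_cball_0)
    have "norm (E s) \<le> 1 / 2" if "Re s \<ge> 1" for s
    proof -
      have "norm (E s) = exp (- (ln 2 * Re s))" by (simp add: E_def)
      also have "\<dots> \<le> exp (- ln 2)" using that by simp
      also have "\<dots> = 1 / 2" by (simp add: exp_minus)
      finally show ?thesis .
    qed
    then show ?thesis using B that[of B] by (simp add: H_def)
  qed
  have "\<Phi> t \<in> G_inf" if "t \<ge> 0" for t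
  proof -
    have hol: "\<Phi> t holomorphic_on half_plane 0"
    proof -
      have "K \<circ> (\<lambda>s. H s + of_real t) holomorphic_on half_plane 0"
      proof (rule holomorphic_on_compose_gen[OF _ holK])
        show "(\<lambda>s. H s + of_real t) holomorphic_on half_plane 0"
          by (intro holomorphic_intros holH)
      qed (use HW shift that in \<open>auto simp: half_plane_def\<close>)
      then show ?thesis by (simp add: \<Phi>_def o_def)
    qed
    have "\<Phi> t ` half_plane 0 \<subseteq> half_plane 0"
      using HW shift that K_pos by (auto simp: \<Phi>_def half_plane_def)
    \<comment> \<open>The displacement as a function of \<open>z = E s\<close>; the coefficient of
      \<open>s\<close> in \<open>\<Phi> t s\<close> is thus \<open>1\<close>.\<close>
    define q where "q = (\<lambda>z. of_real t + l (g z) / c - l (E (of_real t) * g z) / c)"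
    have "q holomorphic_on ball 0 1"
    proof -
      have "E (of_real t) * u \<in> \<Omega>" if "u \<in> \<Omega>" for u
      proof -
        have "E (of_real t) = of_real (exp (- (ln 2 * t)))"
          by (simp add: E_def exp_of_real[symmetric])
        then show ?thesis using star[rule_format, OF that, of "exp (- (ln 2 * t))"] \<open>t \<ge> 0\<close> by simp
      qed
      then have "l \<circ> (\<lambda>z. E (of_real t) * g z) holomorphic_on ball 0 1"
        using g by (intro holomorphic_on_compose_gen[OF _ holl]) (auto intro!: holomorphic_intros holg)
      then show ?thesis
        unfolding q_def o_def by (intro holomorphic_intros hollg) auto
    qed
    then have "(\<lambda>s. q (E s)) \<in> class_D"
      unfolding E_def by (rule class_D_power_series)
    moreover have "\<forall>s\<in>half_plane 0. \<Phi> t s = of_nat 1 * s + q (E s)"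
    proof
      fix s assume "s \<in> half_plane 0"
      then have "E (H s + of_real t) = E (of_real t) * g (E s)"
        by (simp add: half_plane_def E_add EH)
      then show "\<Phi> t s = of_nat 1 * s + q (E s)"
        by (simp add: \<Phi>_def K_def q_def) (simp add: H_def)
    qed
    ultimately have "\<exists>c::nat. \<exists>\<phi>\<in>class_D. \<forall>s\<in>half_plane 0. \<Phi> t s = of_nat c * s + \<phi> s"
      by (intro exI[of _ 1] bexI[of _ "\<lambda>s. q (E s)"])
    moreover have "\<Phi> t analytic_on half_plane 0"
      using hol op by (simp add: analytic_on_open)
    ultimately show ?thesis
      using \<open>\<Phi> t ` half_plane 0 \<subseteq> half_plane 0\<close> unfolding G_inf_def by simp
  qed
  moreover have "\<Phi> 0 s = s" if "s \<in> half_plane 0" for s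
    using that by (simp add: \<Phi>_def KH half_plane_def)
  moreover have "\<Phi> t (\<Phi> u s) = \<Phi> (t + u) s" if "t \<ge> 0" "u \<ge> 0" "s \<in> half_plane 0" for t u s
    using that shift[OF HW[of s] \<open>u \<ge> 0\<close>] HK by (simp add: \<Phi>_def half_plane_def add_ac)
  moreover have "uniform_limit A \<Phi> (\<Phi> 0) (at_right 0)"
    if "compact A" "A \<subseteq> half_plane 0" for A
  proof (rule uniform_limit_at_right_0[OF that(1)])
    have "continuous_on ({0..1} \<times> A) (\<lambda>x. H (snd x))"
      using that(2)
      by (intro continuous_on_compose2[OF holomorphic_on_imp_continuous_on[OF holH]]
          continuous_intros) auto
    then have "continuous_on ({0..1} \<times> A) (\<lambda>x. K (H (snd x) + of_real (fst x)))"
      using that(2) shift HW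
      by (intro continuous_on_compose2[OF holomorphic_on_imp_continuous_on[OF holK]]
          continuous_intros) (auto simp: half_plane_def)
    then show "continuous_on ({0..1} \<times> A) (\<lambda>(t, s). \<Phi> t s)"
      by (simp add: \<Phi>_def case_prod_unfold)
  qed
  ultimately have "continuous_semigroup_G_inf \<Phi>"
    unfolding continuous_semigroup_G_inf_def by simp
  then have "continuous_semigroup_G_inf (\<lambda>t s. K (H s + of_real t))"
    by (simp only: \<Phi>_def)
  from that[OF holH holK _ _ _ _ this] HW K_pos HK B show ?thesis
    by blast
qed

section \<open>The slit plane and its semigroup\<close>

text \<open>The limit angle \<open>0\<close> makes the set closed. The sign is negative because
  \<open>2 powr (-w)\<close> has angle \<open>- (ln 2 * Im w)\<close>; the slits then appear at
  positive heights in the \<open>w\<close>-plane.\<close>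

definition slit_dirs :: "complex set" where
  "slit_dirs = cis ` ((\<lambda>n. - inverse (real (Suc n))) ` UNIV \<union> {0})"

text \<open>\<open>sgn u\<close> is the direction of \<open>u\<close>; at \<open>0\<close>, where it
  takes a default value, the first disjunct decides.\<close>

definition slit_plane :: "complex set" where
  "slit_plane = {u. norm u < 1 \<or> sgn u \<notin> slit_dirs}"

lemma closed_slit_dirs: "closed slit_dirs"
proof -
  have "compact (insert 0 (range (\<lambda>n. - inverse (real (Suc n)))))"
    using tendsto_minus[OF LIMSEQ_inverse_real_of_nat]
    by (intro compact_sequence_with_limit) simp
  then show ?thesis
    unfolding slit_dirs_def
    by (intro compact_imp_closed compact_continuous_image continuous_intros) simp
qed

lemma open_slit_plane: "open slit_plane"
proof -
  have "- slit_plane = {u. norm u \<ge> 1} \<inter> sgn -` slit_dirs"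
    by (auto simp: slit_plane_def)
  \<comment> \<open>The condition \<open>norm u \<ge> 1\<close> keeps away from \<open>0\<close>,
    where \<open>sgn\<close> is discontinuous.\<close>
  moreover have "closed ({u::complex. norm u \<ge> 1} \<inter> sgn -` slit_dirs)"
    by (intro continuous_closed_preimage closed_slit_dirs closed_Collect_le continuous_intros) auto
  ultimately show ?thesis by (metis open_closed)
qed

lemma slit_plane_starlike:
  assumes "u \<in> slit_plane" "r \<in> {0..1}"
  shows "of_real r * u \<in> slit_plane"
proof (cases "norm u < 1 \<or> r = 0")
  case True
  then have "norm (of_real r * u) < 1"
    using assms(2) by (auto simp: norm_mult intro: le_less_trans[OF mult_left_le_one_le])
  then show ?thesis by (simp add: slit_plane_def)
next
  case False
  then have "sgn (of_real r * u) = sgn u"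
    using assms(2) by (simp add: sgn_mult sgn_of_real)
  with assms(1) False show ?thesis by (auto simp: slit_plane_def)
qed

lemma exp_in_slit_plane_iff: "exp (- (of_real (ln 2) * w)) \<in> slit_plane \<longleftrightarrow>
    Re w > 0 \<or> cis (- (ln 2 * Im w)) \<notin> slit_dirs"
proof -
  have "sgn (exp (- (of_real (ln 2) * w))) = cis (- (ln 2 * Im w))"
    unfolding exp_eq_polar[of "- (of_real (ln 2) * w)"]
    by (simp add: sgn_mult sgn_of_real)
  then show ?thesis by (simp add: slit_plane_def zero_less_mult_iff)
qed

text \<open>After a change of sign all angles lie between \<open>0\<close> and \<open>1\<close>,
  where the cosine is injective; so \<open>x\<close> would be a reciprocal strictly between two
  consecutive ones.\<close>

lemma cis_slit_gap:
  assumes "inverse (real (Suc (Suc n))) < x" "x < inverse (real (Suc n))"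
  shows "cis (- x) \<notin> slit_dirs"
proof
  assume "cis (- x) \<in> slit_dirs"
  then obtain z where z: "z = 0 \<or> (\<exists>k. z = - inverse (real (Suc k)))" "cis (- x) = cis z"
    unfolding slit_dirs_def by blast
  define y where "y = - z"
  have y: "y = 0 \<or> (\<exists>k. y = inverse (real (Suc k)))" "cis (- x) = cis (- y)"
    using z by (auto simp: y_def)
  have "0 \<le> y" "y \<le> 1" using y(1) by (auto simp: inverse_le_1_iff)
  have "0 < x" using assms(1) by (rule less_trans[rotated]) simp
  have "x < 1" using assms(2) by (rule less_le_trans) (simp add: field_simps)
  have "cis x = cis y" using y(2) by (metis cis_inverse inverse_inverse_eq)
  then have "cos x = cos y" using cis.simps(1) by metis
  then have "x = y"
    using cos_inj_pi[of x y] \<open>0 < x\<close> \<open>x < 1\<close> \<open>0 \<le> y\<close> \<open>y \<le> 1\<close> pi_gt3 by simp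
  then obtain k where "x = inverse (real (Suc k))" using y(1) \<open>0 < x\<close> by auto
  with assms have "real (Suc k) < real (Suc (Suc n))" "real (Suc n) < real (Suc k)"
    by (simp_all only: inverse_less_iff_less of_nat_0_less_iff zero_less_Suc)
  then show False by simp
qed

theorem theorem6p14:
  shows "\<exists>\<Phi> :: real \<Rightarrow> complex \<Rightarrow> complex.
    continuous_semigroup_G_inf \<Phi> \<and> (\<forall>t>0. \<Phi> t \<notin> G_A)"
proof -
  define W where "W = {w. exp (- (of_real (ln 2) * w)) \<in> slit_plane}"
  \<comment> \<open>Dividing by \<open>ln 2\<close> converts slit angles into heights; with
    \<open>a n = b (Suc n)\<close> each channel lies between consecutive slits.\<close>
  define b where "b = (\<lambda>n. inverse (real (Suc n)) / ln 2)"
  define a where "a = (\<lambda>n. b (Suc n))"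
  have W_iff: "w \<in> W \<longleftrightarrow> Re w > 0 \<or> cis (- (ln 2 * Im w)) \<notin> slit_dirs" for w
    by (simp add: W_def exp_in_slit_plane_iff)
  have "0 \<in> slit_plane" by (simp add: slit_plane_def)
  \<comment> \<open>\<open>1\<close> is the tip of the slit at the limit angle
    \<open>0\<close>.\<close>
  have "1 \<notin> slit_plane" by (auto simp: slit_plane_def slit_dirs_def)
  then have "slit_plane \<noteq> UNIV" by auto
  have star: "\<forall>u\<in>slit_plane. \<forall>r\<in>{0..1}. of_real r * u \<in> slit_plane"
    using slit_plane_starlike by blast
  obtain H K B where HK: "H holomorphic_on half_plane 0" "K holomorphic_on W"
    "\<And>s. Re s > 0 \<Longrightarrow> H s \<in> W" "\<And>w. w \<in> W \<Longrightarrow> Re (K w) > 0"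
    "\<And>w. w \<in> W \<Longrightarrow> H (K w) = w" "\<And>s. Re s \<ge> 1 \<Longrightarrow> norm (H s - s) \<le> B"
    and semigroup: "continuous_semigroup_G_inf (\<lambda>t s. K (H s + of_real t))"
    by (rule starlike_domain_semigroup[OF open_slit_plane \<open>0 \<in> slit_plane\<close>
          \<open>slit_plane \<noteq> UNIV\<close> star W_def]) (rule that)
  have "open W"
  proof -
    have "W = (\<lambda>w. exp (- (of_real (ln 2) * w))) -` slit_plane" by (auto simp: W_def)
    then show ?thesis by (auto intro!: open_vimage open_slit_plane continuous_intros)
  qed
  have slit: "Complex x (b n) \<notin> W" if "x \<le> 0" for x n
    using that by (auto simp: W_iff b_def slit_dirs_def)
  have strip: "w \<in> W" if "a n < Im w" "Im w < b n" for w n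
    using that cis_slit_gap[of n "ln 2 * Im w"]
    by (simp add: W_iff a_def b_def divide_less_eq less_divide_eq mult.commute)
  have "(\<lambda>n. inverse (real (Suc n)) / ln 2) \<longlonglongrightarrow> 0 / ln 2"
    by (intro tendsto_divide LIMSEQ_inverse_real_of_nat tendsto_const) simp
  then have b: "b \<longlonglongrightarrow> 0" by (simp add: b_def)
  then have a: "a \<longlonglongrightarrow> 0" unfolding a_def by (rule LIMSEQ_Suc)
  have "a n < b n" for n
    by (simp add: a_def b_def divide_strict_right_mono)
  then have not_uc: "\<exists>M>0. \<not> uniformly_continuous_on
           {s \<in> half_plane 0. 0 < Re (K (H s + of_real t)) \<and> Re (K (H s + of_real t)) < M}
           (\<lambda>s. K (H s + of_real t))" if "t > 0" for t
    using \<open>t > 0\<close> slit strip W_iff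
    by (intro not_uniformly_continuous_translation[OF HK(1,3,2) \<open>open W\<close> HK(4,5,6),
          where a = a and b = b and L = 0] a b) (auto simp: a_def)
  have "(\<lambda>s. K (H s + of_real t)) \<notin> G_A" if "t > 0" for t
  proof
    assume "(\<lambda>s. K (H s + of_real t)) \<in> G_A"
    then have "\<forall>M>0. uniformly_continuous_on
           {s \<in> half_plane 0. 0 < Re (K (H s + of_real t)) \<and> Re (K (H s + of_real t)) < M}
           (\<lambda>s. K (H s + of_real t))"
      unfolding G_A_def by simp
    with not_uc[OF that] show False by fast
  qed
  with semigroup show ?thesis
    by (intro exI[of _ "\<lambda>t s. K (H s + of_real t)"]) simp
qed

end
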